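(* Consider the automated trading system (ATS) rewriting system and the set of states $L(\Sigma_{NLC})$ described in the context. For every state $\Delta \in L(\Sigma_{NLC})$ and every ATS rule $\sigma$, if $\Delta \xrightarrow{\sigma} \Delta'$ (i.e. $\Delta'$ is obtained from $\Delta$ by one application of $\sigma$), then $\Delta' \in L(\Sigma_{NLC})$.
   Context: Terms. Natural numbers are unary ($\mathsf{z}$, $\mathsf{s}(\cdot)$). Actions are $\mathsf{buy},\mathsf{sell}$, with $\mathrm{dual}(\mathsf{buy},\mathsf{sell})$ and $\mathrm{dual}(\mathsf{sell},\mathsf{buy})$. Order types are $\mathsf{limit},\mathsf{market},\mathsf{cancel}$. Price lists are lists of naturals ($\mathsf{nil}$, $P::L$). Price queues are $\mathsf{nilP}$ or $\mathsf{consP}(ID,N,T,PQ)$ (an entry with identifier $ID$, quantity $N$, timestamp $T$, followed by queue $PQ$). Order queues are $\mathsf{empty}$ or $\mathsf{front}(o,Q)$ where $o=\mathsf{ordN}(O,A,P,ID,N,T)$ (order type, action, price, identifier, quantity, timestamp). States are finite multisets of linear facts of the forms $\mathsf{begin}$, $\mathsf{order}(O,A,P,ID,N)$, $\mathsf{orderQ}(Q)$, $\mathsf{priceQ}(A,P,PQ)$, $\mathsf{active}(A,L)$, $\mathsf{time}(T)$. A rule has a multiset of consumed facts, side conditions, and a multiset of produced facts; $\Delta\xrightarrow{\sigma}\Delta'$ means that for some instantiation of the rule's variables satisfying the side conditions, the consumed facts form a sub-multiset of $\Delta$, and $\Delta'$ is $\Delta$ with them removed and the produced facts added. Side conditions (not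 consuming facts): $\mathrm{enq}(Q,o,Q')$: $Q'$ is $Q$ with $o$ appended at the end. $\mathrm{store}(\mathsf{buy},L,P)$: every element of $L$ is $>P$; $\mathrm{store}(\mathsf{sell},L,P)$: every element of $L$ is $<P$. $\mathrm{exchange}(\mathsf{buy},L,P,X)$: $L$ nonempty, $X=\min L$ and $X\le P$; $\mathrm{exchange}(\mathsf{sell},L,P,X)$: $L$ nonempty, $X=\max L$ and $X\ge P$. $\mathrm{mktExchange}(\mathsf{buy},L,X)$: $L$ nonempty, $X=\min L$; $\mathrm{mktExchange}(\mathsf{sell},L,X)$: $L$ nonempty, $X=\max L$. $\mathrm{notInList}(L,P)$: $P\notin L$. $\mathrm{ins}(L,P,L')$: $L'$ is $L$ with $P$ inserted. $\mathrm{remove}(L,X,L')$: $L'$ is $L$ with $X$ removed. $\mathrm{ext}(PQ,ID,N,T,PQ')$: $PQ'$ is $PQ$ with entry $(ID,N,T)$ appended at the end. $\mathrm{inListF}(PQ,ID)$ / $\mathrm{notInListF}(PQ,ID)$: $PQ$ does / does not contain an entry with identifier $ID$; $\mathrm{removeF}(PQ,ID,PQ')$: $PQ'$ is $PQ$ with that entry removed. $N''=N-N'$ etc. are ordinary arithmetic. Below, $\mathrm{dual}(A,A')$ is a side condition of every rule mentioning $A'$, and $F_O := \mathsf{orderQ}(\mathsf{front}(\mathsf{ordN}(O,A,P,ID,N,T),Q))$. ATS rules (consumed $\Rightarrow$ produced; [side conditions]): - begin: $\mathsf{begin}\Rightarrow \mathsf{orderQ}(\mathsf{empty}),\mathsf{active}(\mathsf{buy},\mathsf{nil}),\mathsf{active}(\mathsf{sell},\mathsf{nil}),\mathsf{time}(\mathsf{z})$.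 - enqueue: $\mathsf{order}(O,A,P,ID,N),\mathsf{orderQ}(Q),\mathsf{time}(T)\Rightarrow\mathsf{orderQ}(Q'),\mathsf{time}(\mathsf{s}(T))$ [$\mathrm{enq}(Q,\mathsf{ordN}(O,A,P,ID,N,T),Q')$]. - limit/empty: $F_{\mathsf{limit}},\mathsf{active}(A',L'),\mathsf{active}(A,L),\mathsf{time}(T)\Rightarrow \mathsf{orderQ}(Q),\mathsf{active}(A',L'),\mathsf{priceQ}(A,P,\mathsf{consP}(ID,N,T,\mathsf{nilP})),\mathsf{active}(A,LP),\mathsf{time}(\mathsf{s}(T))$ [$\mathrm{store}(A,L',P)$, $\mathrm{notInList}(L,P)$, $\mathrm{ins}(L,P,LP)$]. - limit/queue: $F_{\mathsf{limit}},\mathsf{active}(A',L'),\mathsf{priceQ}(A,P,PQ),\mathsf{time}(T)\Rightarrow\mathsf{orderQ}(Q),\mathsf{active}(A',L'),\mathsf{priceQ}(A,P,PQ'),\mathsf{time}(\mathsf{s}(T))$ [$\mathrm{store}(A,L',P)$, $\mathrm{ext}(PQ,ID,N,T,PQ')$]. - limit/1: $F_{\mathsf{limit}},\mathsf{active}(A',L'),\mathsf{priceQ}(A',X,\mathsf{consP}(ID',N',T',\mathsf{nilP})),\mathsf{time}(T)\Rightarrow\mathsf{orderQ}(Q),\mathsf{active}(A',L''),\mathsf{time}(\mathsf{s}(T))$ [$\mathrm{exchange}(A,L',P,X)$, $\mathrm{remove}(L',X,L'')$, $N=N'$]. - limit/2: $F_{\mathsf{limit}},\mathsf{active}(A',L'),\mathsf{priceQ}(A',X,\mathsf{consP}(ID',N',T',\mathsf{consP}(ID_1,N_1,T_1,L))),\mathsf{time}(T)\Rightarrow\mathsf{orderQ}(Q),\mathsf{active}(A',L'),\mathsf{priceQ}(A',X,\mathsf{consP}(ID_1,N_1,T_1,L)),\mathsf{time}(\mathsf{s}(T))$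 [$\mathrm{exchange}(A,L',P,X)$, $N=N'$]. - limit/3: $F_{\mathsf{limit}},\mathsf{active}(A',L'),\mathsf{priceQ}(A',X,\mathsf{consP}(ID',N',T',\mathsf{nilP}))\Rightarrow\mathsf{orderQ}(\mathsf{front}(\mathsf{ordN}(\mathsf{limit},A,P,ID,N'',T),Q)),\mathsf{active}(A',L'')$ [$\mathrm{exchange}(A,L',P,X)$, $\mathrm{remove}(L',X,L'')$, $N>N'$, $N''=N-N'$]. - limit/4: $F_{\mathsf{limit}},\mathsf{active}(A',L'),\mathsf{priceQ}(A',X,\mathsf{consP}(ID',N',T',\mathsf{consP}(ID_1,N_1,T_1,L)))\Rightarrow\mathsf{orderQ}(\mathsf{front}(\mathsf{ordN}(\mathsf{limit},A,P,ID,N'',T),Q)),\mathsf{active}(A',L'),\mathsf{priceQ}(A',X,\mathsf{consP}(ID_1,N_1,T_1,L))$ [$\mathrm{exchange}(A,L',P,X)$, $N>N'$, $N''=N-N'$]. - limit/5: $F_{\mathsf{limit}},\mathsf{active}(A',L'),\mathsf{priceQ}(A',X,\mathsf{consP}(ID',N',T',L)),\mathsf{time}(T)\Rightarrow\mathsf{orderQ}(Q),\mathsf{active}(A',L'),\mathsf{priceQ}(A',X,\mathsf{consP}(ID',N'',T',L)),\mathsf{time}(\mathsf{s}(T))$ [$\mathrm{exchange}(A,L',P,X)$, $N<N'$, $N''=N'-N$]. - market/empty: $F_{\mathsf{market}},\mathsf{active}(A',\mathsf{nil}),\mathsf{time}(T)\Rightarrow\mathsf{orderQ}(Q),\mathsf{active}(A',\mathsf{nil}),\mathsf{time}(\mathsf{s}(T))$.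 - market/$i$ for $i=1,\dots,5$: identical to limit/$i$ except that the consumed order-queue fact is $F_{\mathsf{market}}$ and the side condition $\mathrm{exchange}(A,L',P,X)$ is replaced by $\mathrm{mktExchange}(A,L',X)$; in market/3 and market/4 the produced order-queue fact is $\mathsf{orderQ}(\mathsf{front}(\mathsf{ordN}(\mathsf{limit},A,P,ID,N'',T),Q))$. - cancel/inListNil: $F_{\mathsf{cancel}},\mathsf{active}(A,L'),\mathsf{priceQ}(A,P,\mathsf{consP}(ID,N,T',\mathsf{nilP})),\mathsf{time}(T)\Rightarrow\mathsf{orderQ}(Q),\mathsf{active}(A,L''),\mathsf{time}(\mathsf{s}(T))$ [$\mathrm{remove}(L',P,L'')$]. - cancel/inListCons: $F_{\mathsf{cancel}},\mathsf{priceQ}(A,P,PQ),\mathsf{time}(T)\Rightarrow\mathsf{orderQ}(Q),\mathsf{priceQ}(A,P,PQ'),\mathsf{time}(\mathsf{s}(T))$ [$\mathrm{inListF}(PQ,ID)$, $\mathrm{removeF}(PQ,ID,PQ')$]. - cancel/notInListQueue: $F_{\mathsf{cancel}},\mathsf{priceQ}(A,P,PQ),\mathsf{time}(T)\Rightarrow\mathsf{orderQ}(Q),\mathsf{priceQ}(A,P,PQ),\mathsf{time}(\mathsf{s}(T))$ [$\mathrm{notInListF}(PQ,ID)$]. - cancel/notInListActive: $F_{\mathsf{cancel}},\mathsf{active}(A,L'),\mathsf{time}(T)\Rightarrow\mathsf{orderQ}(Q),\mathsf{active}(A,L'),\mathsf{time}(\mathsf{s}(T))$ [$\mathrm{notInList}(L',P)$].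 The language $L(\Sigma_{NLC})$ (generated by a generative grammar) is the set of all multisets of the form $\{\mathsf{orderQ}(Q),\mathsf{active}(\mathsf{buy},L_B),\mathsf{active}(\mathsf{sell},L_S),\mathsf{time}(T)\}$ together with, for each entry $P$ of the list $L_B$ (counted with multiplicity), one fact $\mathsf{priceQ}(\mathsf{buy},P,PQ)$ with an arbitrary price queue $PQ$, and for each entry $P$ of $L_S$ one fact $\mathsf{priceQ}(\mathsf{sell},P,PQ)$ with arbitrary $PQ$, where $Q,T,L_B,L_S$ are arbitrary subject to the guard $\max L_B<\min L_S$ (the bid price is strictly below the ask price). *)

theory Defs
  imports "HOL-Library.Multiset"
begin

section \<open>Terms, facts and states\<close>

datatype action = Buy | Sell

datatype order_type = Limit | Market | Cancel

type_synonym price = nat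
type_synonym ident = nat
type_synonym quantity = nat
type_synonym timestamp = nat

datatype price_queue = NilP | ConsP ident quantity timestamp price_queue

datatype queued_order = OrdN order_type action price ident quantity timestamp

datatype order_queue = EmptyQ | FrontQ queued_order order_queue

datatype fact =
    Begin
  | Order order_type action price ident quantity
  | OrderQ order_queue
  | PriceQ action price price_queue
  | Active action "price list"
  | Time timestamp

type_synonym state = "fact multiset"


section \<open>Side conditions\<close>

inductive dual :: "action \<Rightarrow> action \<Rightarrow> bool" where
  "dual Buy Sell"
| "dual Sell Buy"

inductive enq :: "order_queue \<Rightarrow> queued_order \<Rightarrow> order_queue \<Rightarrow> bool" where
  "enq EmptyQ x (FrontQ x EmptyQ)"
| "enq Q x Q' \<Longrightarrow> enq (FrontQ y Q) x (FrontQ y Q')"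

fun store :: "action \<Rightarrow> price list \<Rightarrow> price \<Rightarrow> bool" where
  "store Buy L P \<longleftrightarrow> (\<forall>Y \<in> set L. Y > P)"
| "store Sell L P \<longleftrightarrow> (\<forall>Y \<in> set L. Y < P)"

fun exchange :: "action \<Rightarrow> price list \<Rightarrow> price \<Rightarrow> price \<Rightarrow> bool" where
  "exchange Buy L P X \<longleftrightarrow> L \<noteq> [] \<and> X = Min (set L) \<and> X \<le> P"
| "exchange Sell L P X \<longleftrightarrow> L \<noteq> [] \<and> X = Max (set L) \<and> X \<ge> P"

fun mktExchange :: "action \<Rightarrow> price list \<Rightarrow> price \<Rightarrow> bool" where
  "mktExchange Buy L X \<longleftrightarrow> L \<noteq> [] \<and> X = Min (set L)"
| "mktExchange Sell L X \<longleftrightarrow> L \<noteq> [] \<and> X = Max (set L)"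

definition notInList :: "price list \<Rightarrow> price \<Rightarrow> bool" where
  "notInList L P \<longleftrightarrow> P \<notin> set L"

text \<open>The position of an insertion is left open. A removal deletes a single occurrence,
  since the entries of an active list are counted with multiplicity; which occurrence is
  left open as well.\<close>

definition ins :: "price list \<Rightarrow> price \<Rightarrow> price list \<Rightarrow> bool" where
  "ins L P L' \<longleftrightarrow> (\<exists>xs ys. L = xs @ ys \<and> L' = xs @ P # ys)"

definition remove :: "price list \<Rightarrow> price \<Rightarrow> price list \<Rightarrow> bool" where
  "remove L X L' \<longleftrightarrow> (\<exists>xs ys. L = xs @ X # ys \<and> L' = xs @ ys)"

inductive ext ::
  "price_queue \<Rightarrow> ident \<Rightarrow> quantity \<Rightarrow> timestamp \<Rightarrow> price_queue \<Rightarrow> bool" where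
  "ext NilP ID N T (ConsP ID N T NilP)"
| "ext PQ ID N T PQ' \<Longrightarrow> ext (ConsP ID' N' T' PQ) ID N T (ConsP ID' N' T' PQ')"

primrec inListF :: "price_queue \<Rightarrow> ident \<Rightarrow> bool" where
  "inListF NilP ID \<longleftrightarrow> False"
| "inListF (ConsP ID' N T PQ) ID \<longleftrightarrow> ID' = ID \<or> inListF PQ ID"

definition notInListF :: "price_queue \<Rightarrow> ident \<Rightarrow> bool" where
  "notInListF PQ ID \<longleftrightarrow> \<not> inListF PQ ID"

inductive removeF :: "price_queue \<Rightarrow> ident \<Rightarrow> price_queue \<Rightarrow> bool" where
  "removeF (ConsP ID N T PQ) ID PQ"
| "removeF PQ ID PQ' \<Longrightarrow> removeF (ConsP ID' N T PQ) ID (ConsP ID' N T PQ')"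


section \<open>The rewriting system\<close>

datatype ats_rule =
    Rbegin | Renqueue
  | Rlimit_empty | Rlimit_queue | Rlimit_1 | Rlimit_2 | Rlimit_3 | Rlimit_4 | Rlimit_5
  | Rmarket_empty | Rmarket_1 | Rmarket_2 | Rmarket_3 | Rmarket_4 | Rmarket_5
  | Rcancel_inListNil | Rcancel_inListCons | Rcancel_notInListQueue | Rcancel_notInListActive

abbreviation frontOrd ::
  "order_type \<Rightarrow> action \<Rightarrow> price \<Rightarrow> ident \<Rightarrow> quantity \<Rightarrow> timestamp \<Rightarrow> order_queue \<Rightarrow> fact" where
  "frontOrd Ot A P ID N T Q \<equiv> OrderQ (FrontQ (OrdN Ot A P ID N T) Q)"

text \<open>\<open>rule_instance \<sigma> C D\<close>: some instantiation of the variables of \<open>\<sigma>\<close> satisfying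
  its side conditions has consumed facts \<open>C\<close> and produced facts \<open>D\<close>.\<close>

inductive rule_instance :: "ats_rule \<Rightarrow> state \<Rightarrow> state \<Rightarrow> bool" where
  begin_rule:
  "rule_instance Rbegin
     {# Begin #}
     {# OrderQ EmptyQ, Active Buy [], Active Sell [], Time 0 #}"
| enqueue:
  "enq Q (OrdN Ot A P ID N T) Q' \<Longrightarrow>
   rule_instance Renqueue
     {# Order Ot A P ID N, OrderQ Q, Time T #}
     {# OrderQ Q', Time (Suc T) #}"
| limit_empty:
  "\<lbrakk>dual A A'; store A L' P; notInList L P; ins L P LP\<rbrakk> \<Longrightarrow>
   rule_instance Rlimit_empty
     {# frontOrd Limit A P ID N T Q, Active A' L', Active A L, Time T #}
     {# OrderQ Q, Active A' L', PriceQ A P (ConsP ID N T NilP), Active A LP, Time (Suc T) #}"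
| limit_queue:
  "\<lbrakk>dual A A'; store A L' P; ext PQ ID N T PQ'\<rbrakk> \<Longrightarrow>
   rule_instance Rlimit_queue
     {# frontOrd Limit A P ID N T Q, Active A' L', PriceQ A P PQ, Time T #}
     {# OrderQ Q, Active A' L', PriceQ A P PQ', Time (Suc T) #}"
| limit_1:
  "\<lbrakk>dual A A'; exchange A L' P X; remove L' X L''; N = N'\<rbrakk> \<Longrightarrow>
   rule_instance Rlimit_1
     {# frontOrd Limit A P ID N T Q, Active A' L', PriceQ A' X (ConsP ID' N' T' NilP), Time T #}
     {# OrderQ Q, Active A' L'', Time (Suc T) #}"
| limit_2:
  "\<lbrakk>dual A A'; exchange A L' P X; N = N'\<rbrakk> \<Longrightarrow>
   rule_instance Rlimit_2
     {# frontOrd Limit A P ID N T Q, Active A' L',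
        PriceQ A' X (ConsP ID' N' T' (ConsP ID1 N1 T1 L)), Time T #}
     {# OrderQ Q, Active A' L', PriceQ A' X (ConsP ID1 N1 T1 L), Time (Suc T) #}"
| limit_3:
  "\<lbrakk>dual A A'; exchange A L' P X; remove L' X L''; N > N'; N'' = N - N'\<rbrakk> \<Longrightarrow>
   rule_instance Rlimit_3
     {# frontOrd Limit A P ID N T Q, Active A' L', PriceQ A' X (ConsP ID' N' T' NilP) #}
     {# frontOrd Limit A P ID N'' T Q, Active A' L'' #}"
| limit_4:
  "\<lbrakk>dual A A'; exchange A L' P X; N > N'; N'' = N - N'\<rbrakk> \<Longrightarrow>
   rule_instance Rlimit_4
     {# frontOrd Limit A P ID N T Q, Active A' L',
        PriceQ A' X (ConsP ID' N' T' (ConsP ID1 N1 T1 L)) #}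
     {# frontOrd Limit A P ID N'' T Q, Active A' L', PriceQ A' X (ConsP ID1 N1 T1 L) #}"
| limit_5:
  "\<lbrakk>dual A A'; exchange A L' P X; N < N'; N'' = N' - N\<rbrakk> \<Longrightarrow>
   rule_instance Rlimit_5
     {# frontOrd Limit A P ID N T Q, Active A' L', PriceQ A' X (ConsP ID' N' T' L), Time T #}
     {# OrderQ Q, Active A' L', PriceQ A' X (ConsP ID' N'' T' L), Time (Suc T) #}"
| market_empty:
  "dual A A' \<Longrightarrow>
   rule_instance Rmarket_empty
     {# frontOrd Market A P ID N T Q, Active A' [], Time T #}
     {# OrderQ Q, Active A' [], Time (Suc T) #}"
| market_1:
  "\<lbrakk>dual A A'; mktExchange A L' X; remove L' X L''; N = N'\<rbrakk> \<Longrightarrow>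
   rule_instance Rmarket_1
     {# frontOrd Market A P ID N T Q, Active A' L', PriceQ A' X (ConsP ID' N' T' NilP), Time T #}
     {# OrderQ Q, Active A' L'', Time (Suc T) #}"
| market_2:
  "\<lbrakk>dual A A'; mktExchange A L' X; N = N'\<rbrakk> \<Longrightarrow>
   rule_instance Rmarket_2
     {# frontOrd Market A P ID N T Q, Active A' L',
        PriceQ A' X (ConsP ID' N' T' (ConsP ID1 N1 T1 L)), Time T #}
     {# OrderQ Q, Active A' L', PriceQ A' X (ConsP ID1 N1 T1 L), Time (Suc T) #}"
| market_3:
  "\<lbrakk>dual A A'; mktExchange A L' X; remove L' X L''; N > N'; N'' = N - N'\<rbrakk> \<Longrightarrow>
   rule_instance Rmarket_3
     {# frontOrd Market A P ID N T Q, Active A' L', PriceQ A' X (ConsP ID' N' T' NilP) #}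
     {# frontOrd Limit A P ID N'' T Q, Active A' L'' #}"
| market_4:
  "\<lbrakk>dual A A'; mktExchange A L' X; N > N'; N'' = N - N'\<rbrakk> \<Longrightarrow>
   rule_instance Rmarket_4
     {# frontOrd Market A P ID N T Q, Active A' L',
        PriceQ A' X (ConsP ID' N' T' (ConsP ID1 N1 T1 L)) #}
     {# frontOrd Limit A P ID N'' T Q, Active A' L', PriceQ A' X (ConsP ID1 N1 T1 L) #}"
| market_5:
  "\<lbrakk>dual A A'; mktExchange A L' X; N < N'; N'' = N' - N\<rbrakk> \<Longrightarrow>
   rule_instance Rmarket_5
     {# frontOrd Market A P ID N T Q, Active A' L', PriceQ A' X (ConsP ID' N' T' L), Time T #}
     {# OrderQ Q, Active A' L', PriceQ A' X (ConsP ID' N'' T' L), Time (Suc T) #}"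
| cancel_inListNil:
  "remove L' P L'' \<Longrightarrow>
   rule_instance Rcancel_inListNil
     {# frontOrd Cancel A P ID N T Q, Active A L', PriceQ A P (ConsP ID N T' NilP), Time T #}
     {# OrderQ Q, Active A L'', Time (Suc T) #}"
| cancel_inListCons:
  "\<lbrakk>inListF PQ ID; removeF PQ ID PQ'\<rbrakk> \<Longrightarrow>
   rule_instance Rcancel_inListCons
     {# frontOrd Cancel A P ID N T Q, PriceQ A P PQ, Time T #}
     {# OrderQ Q, PriceQ A P PQ', Time (Suc T) #}"
| cancel_notInListQueue:
  "notInListF PQ ID \<Longrightarrow>
   rule_instance Rcancel_notInListQueue
     {# frontOrd Cancel A P ID N T Q, PriceQ A P PQ, Time T #}
     {# OrderQ Q, PriceQ A P PQ, Time (Suc T) #}"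
| cancel_notInListActive:
  "notInList L' P \<Longrightarrow>
   rule_instance Rcancel_notInListActive
     {# frontOrd Cancel A P ID N T Q, Active A L', Time T #}
     {# OrderQ Q, Active A L', Time (Suc T) #}"

definition ats_step :: "ats_rule \<Rightarrow> state \<Rightarrow> state \<Rightarrow> bool" where
  "ats_step \<sigma> \<Delta> \<Delta>' \<longleftrightarrow>
     (\<exists>C D. rule_instance \<sigma> C D \<and> C \<subseteq># \<Delta> \<and> \<Delta>' = \<Delta> - C + D)"


section \<open>The language of states with no locked or crossed market\<close>

text \<open>An empty side imposes no constraint (the maximum of an empty list of bids is below,
  and the minimum of an empty list of asks above, every price).\<close>

definition bid_below_ask :: "price list \<Rightarrow> price list \<Rightarrow> bool" where
  "bid_below_ask LB LS \<longleftrightarrow> LB = [] \<or> LS = [] \<or> Max (set LB) < Min (set LS)"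

definition price_facts :: "action \<Rightarrow> price list \<Rightarrow> price_queue list \<Rightarrow> state" where
  "price_facts A L PQs = mset (map2 (PriceQ A) L PQs)"

definition L_NLC :: "state set" where
  "L_NLC =
     {{# OrderQ Q, Active Buy LB, Active Sell LS, Time T #}
        + price_facts Buy LB QB + price_facts Sell LS QS | Q LB LS T QB QS.
      length QB = length LB \<and> length QS = length LS \<and> bid_below_ask LB LS}"

end

theory Submission
  imports Defs
begin

text \<open>Sort the facts of a state by kind. Membership in the language then says that there is
  exactly one order queue, one clock and one active list per action, no pending order or
  \<^const>\<open>Begin\<close>, that the prices carrying a price queue agree, as multisets, with the
  active list of their action, and that every bid is below every ask. All these collections
  are additive in the state, so for each rule it suffices to compare its consumed and produced
  facts. The guard can only be endangered by inserting a price, which is done by the rule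
  limit/empty alone, where the condition \<^const>\<open>store\<close> is precisely what is needed.\<close>

fun order_queue_of :: "fact \<Rightarrow> order_queue multiset" where
  "order_queue_of (OrderQ Q) = {#Q#}"
| "order_queue_of _ = {#}"

fun active_list_of :: "action \<Rightarrow> fact \<Rightarrow> price list multiset" where
  "active_list_of A (Active B L) = (if B = A then {#L#} else {#})"
| "active_list_of A _ = {#}"

fun time_of :: "fact \<Rightarrow> timestamp multiset" where
  "time_of (Time T) = {#T#}"
| "time_of _ = {#}"

fun price_queue_of :: "action \<Rightarrow> fact \<Rightarrow> (price \<times> price_queue) multiset" where
  "price_queue_of A (PriceQ B P PQ) = (if B = A then {#(P, PQ)#} else {#})"
| "price_queue_of A _ = {#}"

text \<open>Collects the kinds of fact that no state of the language contains, so that together the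
  extractors account for every fact.\<close>

fun unprocessed_of :: "fact \<Rightarrow> fact multiset" where
  "unprocessed_of Begin = {#Begin#}"
| "unprocessed_of (Order Ot A P ID N) = {#Order Ot A P ID N#}"
| "unprocessed_of _ = {#}"

definition gather :: "('a \<Rightarrow> 'b multiset) \<Rightarrow> 'a multiset \<Rightarrow> 'b multiset" where
  "gather f M = \<Sum>\<^sub># (image_mset f M)"

lemma gather_simps [simp]:
  "gather f {#} = {#}"
  "gather f (add_mset x M) = f x + gather f M"
  "gather f (M + N) = gather f M + gather f N"
  by (simp_all add: gather_def)

text \<open>Each single fact contributes to exactly one summand, so sorting loses nothing. This lets
  a state be rebuilt from its collections when membership in \<open>L_NLC\<close> is to be
  shown.\<close>

lemma state_decomposition:
  "\<Delta> = image_mset OrderQ (gather order_queue_of \<Delta>)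
     + image_mset (Active Buy) (gather (active_list_of Buy) \<Delta>)
     + image_mset (Active Sell) (gather (active_list_of Sell) \<Delta>)
     + image_mset Time (gather time_of \<Delta>)
     + image_mset (case_prod (PriceQ Buy)) (gather (price_queue_of Buy) \<Delta>)
     + image_mset (case_prod (PriceQ Sell)) (gather (price_queue_of Sell) \<Delta>)
     + gather unprocessed_of \<Delta>"
proof (induction \<Delta>)
  case empty
  show ?case by simp
next
  case (add x \<Delta>)
  \<comment> \<open>Guarantees that an \<open>Active\<close> or \<open>PriceQ\<close> fact passes
    the action test of one of its two summands.\<close>
  have "A = Buy \<or> A = Sell" for A
    by (cases A) simp_all
  with add show ?case
    by (cases x) (auto simp: ac_simps)
qed

lemma price_facts_conv_image_mset:
  "price_facts A L PQs = image_mset (case_prod (PriceQ A)) (mset (zip L PQs))"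
  by (simp add: price_facts_def)

lemma gather_price_facts:
  assumes "length PQs = length L"
  shows "gather order_queue_of (price_facts A L PQs) = {#}"
    and "gather (active_list_of B) (price_facts A L PQs) = {#}"
    and "gather time_of (price_facts A L PQs) = {#}"
    and "gather unprocessed_of (price_facts A L PQs) = {#}"
    and "image_mset fst (gather (price_queue_of B) (price_facts A L PQs))
           = (if A = B then mset L else {#})"
  using assms by (induction PQs L rule: list_induct2) (auto simp: price_facts_def)

text \<open>Going through \<open>xs\<close> in order, choose for each entry a pair of
  \<open>M\<close> carrying it and remove that pair; for a repeated entry any choice works. This
  aligns the price queues with the active list as \<open>price_facts\<close> demands.\<close>

lemma image_mset_fst_eq_mset_conv_zip:
  assumes "image_mset fst M = mset xs"
  obtains ys where "length ys = length xs" "M = mset (zip xs ys)"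
proof -
  have "\<exists>ys. length ys = length xs \<and> M = mset (zip xs ys)"
    using assms
  proof (induction xs arbitrary: M)
    case Nil
    then show ?case by simp
  next
    case (Cons x xs)
    then obtain y M' where M: "M = add_mset (x, y) M'" "image_mset fst M' = mset xs"
      by (auto dest!: msed_map_invR)
    then obtain ys where "length ys = length xs" "M' = mset (zip xs ys)"
      using Cons.IH by blast
    with M show ?case
      by (intro exI[of _ "y # ys"]) simp
  qed
  then show thesis using that by blast
qed

text \<open>In the pointwise form empty sides hold vacuously, and the guard visibly survives passing
  to sublists.\<close>

lemma bid_below_ask_iff: "bid_below_ask LB LS \<longleftrightarrow> (\<forall>x \<in> set LB. \<forall>y \<in> set LS. x < y)"
  by (cases "LB = []"; cases "LS = []") (auto simp: bid_below_ask_def)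

lemma L_NLC_iff:
  "\<Delta> \<in> L_NLC \<longleftrightarrow>
     (\<exists>Q LB LS T. gather order_queue_of \<Delta> = {#Q#}
        \<and> gather (active_list_of Buy) \<Delta> = {#LB#}
        \<and> gather (active_list_of Sell) \<Delta> = {#LS#}
        \<and> gather time_of \<Delta> = {#T#}
        \<and> gather unprocessed_of \<Delta> = {#}
        \<and> image_mset fst (gather (price_queue_of Buy) \<Delta>) = mset LB
        \<and> image_mset fst (gather (price_queue_of Sell) \<Delta>) = mset LS
        \<and> (\<forall>x \<in> set LB. \<forall>y \<in> set LS. x < y))"
  (is "_ \<longleftrightarrow> ?R")
proof
  assume "\<Delta> \<in> L_NLC"
  then show ?R
    by (auto simp: L_NLC_def gather_price_facts bid_below_ask_iff)
next
  assume ?R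
  then obtain Q LB LS T where
    parts: "gather order_queue_of \<Delta> = {#Q#}" "gather (active_list_of Buy) \<Delta> = {#LB#}"
      "gather (active_list_of Sell) \<Delta> = {#LS#}" "gather time_of \<Delta> = {#T#}"
      "gather unprocessed_of \<Delta> = {#}"
    and bids: "image_mset fst (gather (price_queue_of Buy) \<Delta>) = mset LB"
    and asks: "image_mset fst (gather (price_queue_of Sell) \<Delta>) = mset LS"
    and guard: "bid_below_ask LB LS"
    unfolding bid_below_ask_iff by blast
  obtain QB where QB: "length QB = length LB" "gather (price_queue_of Buy) \<Delta> = mset (zip LB QB)"
    using bids by (rule image_mset_fst_eq_mset_conv_zip)
  obtain QS where QS: "length QS = length LS" "gather (price_queue_of Sell) \<Delta> = mset (zip LS QS)"
    using asks by (rule image_mset_fst_eq_mset_conv_zip)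
  have "\<Delta> = {# OrderQ Q, Active Buy LB, Active Sell LS, Time T #}
      + price_facts Buy LB QB + price_facts Sell LS QS"
    by (subst state_decomposition) (simp add: parts QB QS price_facts_conv_image_mset)
  with QB(1) QS(1) guard show "\<Delta> \<in> L_NLC"
    unfolding L_NLC_def by blast
qed

lemma rule_instance_preserves_L_NLC:
  assumes "rule_instance \<sigma> C D" "C + R \<in> L_NLC"
  shows "D + R \<in> L_NLC"
  using assms
proof (cases rule: rule_instance.cases)
  \<comment> \<open>Fixing both actions unfolds \<open>store\<close> to a comparison of
    \<open>P\<close> with every price of the opposite list; the new price queue matches the inserted
    entry.\<close>
  case (limit_empty A A' L' P L LP ID N T Q)
  then show ?thesis
    using assms(2) by (cases A; cases A') (auto simp: L_NLC_iff ins_def dual.simps)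
\<comment> \<open>Consuming \<open>Begin\<close> or an \<open>Order\<close> contradicts membership.
  Otherwise prices are kept, or one occurrence leaves the active list together with its price
  queue.\<close>
qed (use assms(2) in \<open>auto simp: L_NLC_iff remove_def dual.simps split: if_splits\<close>)

theorem theorem1:
  fixes \<Delta> \<Delta>' :: state and \<sigma> :: ats_rule
  assumes "\<Delta> \<in> L_NLC"
    and "ats_step \<sigma> \<Delta> \<Delta>'"
  shows "\<Delta>' \<in> L_NLC"
proof -
  obtain C D where CD: "rule_instance \<sigma> C D" "C \<subseteq># \<Delta>" "\<Delta>' = \<Delta> - C + D"
    using assms(2) unfolding ats_step_def by blast
  have "C + (\<Delta> - C) \<in> L_NLC"
    using assms(1) CD(2) by simp
  with CD(1) have "D + (\<Delta> - C) \<in> L_NLC"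
    by (rule rule_instance_preserves_L_NLC)
  with CD(3) show ?thesis
    by (simp add: add.commute)
qed

end
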